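(* Let $n\ge 3$ be an odd integer, $d,k\ge1$ integers, and $E\subset\mathbb{Z}_n^d$. Suppose that \[ |E| \gg \frac{\sqrt{\tau(n)}\, n^{d+\frac{k-1}{2}}}{\gamma(n)^{(d-1)/2}}. \] Then \[ \frac{1}{|E|^k}\sum_{y^1,\dots,y^k\in E} \left|\Delta_{y^1,\dots,y^k}(E)\right| \gg n^k. \]
   Context: For $x\in\mathbb{Z}_n^d$, $\|x\|=x_1^2+\dots+x_d^2\in\mathbb{Z}_n$. For $y^1,\dots,y^k\in\mathbb{Z}_n^d$, the $k$-star set is $\Delta_{y^1,\dots,y^k}(E)=\{(\|x-y^1\|,\dots,\|x-y^k\|)\in\mathbb{Z}_n^k : x\in E\}$. $\gamma(n)$ is the smallest prime divisor of $n$ and $\tau(n)$ the number of divisors of $n$. $X\gg Y$ means $X\ge CY$ for a constant $C>0$ independent of $n$ and $E$ (possibly depending on $d,k$); a hypothesis $|E|\gg Y$ means $|E|\ge CY$ for a suitable sufficiently large such constant. *)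

theory Defs
  imports Complex_Main "HOL-Library.FuncSet" "HOL-Number_Theory.Number_Theory"
begin

text \<open>
  The ring of integers modulo \<open>n\<close> is the library's \<open>residue_ring (int n)\<close>, with carrier
  \<open>{0..int n - 1}\<close>. Elements of \<open>\<int>\<^sub>n\<^sup>d\<close> are the extensional functions from \<open>{..<d}\<close> to it,
  so coordinates are numbered from 0, and the same encoding is used for \<open>k\<close>-tuples.
\<close>

abbreviation Zn :: "nat \<Rightarrow> int ring" where
  "Zn n \<equiv> residue_ring (int n)"

definition Znd :: "nat \<Rightarrow> nat \<Rightarrow> (nat \<Rightarrow> int) set" where
  "Znd n d = {..<d} \<rightarrow>\<^sub>E carrier (Zn n)"

definition vec_diff :: "nat \<Rightarrow> nat \<Rightarrow> (nat \<Rightarrow> int) \<Rightarrow> (nat \<Rightarrow> int) \<Rightarrow> (nat \<Rightarrow> int)" where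
  "vec_diff n d x y = (\<lambda>i\<in>{..<d}. x i \<ominus>\<^bsub>Zn n\<^esub> y i)"

definition sq_norm :: "nat \<Rightarrow> nat \<Rightarrow> (nat \<Rightarrow> int) \<Rightarrow> int" where
  "sq_norm n d x = (\<Oplus>\<^bsub>Zn n\<^esub>i\<in>{..<d}. x i [^]\<^bsub>Zn n\<^esub> (2::nat))"

definition star_set ::
    "nat \<Rightarrow> nat \<Rightarrow> nat \<Rightarrow> (nat \<Rightarrow> nat \<Rightarrow> int) \<Rightarrow> (nat \<Rightarrow> int) set \<Rightarrow> (nat \<Rightarrow> int) set" where
  "star_set n d k y E = (\<lambda>x. \<lambda>j\<in>{..<k}. sq_norm n d (vec_diff n d x (y j))) ` E"

definition least_prime_divisor :: "nat \<Rightarrow> nat" where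
  "least_prime_divisor n = (LEAST p. prime p \<and> p dvd n)"

definition num_divisors :: "nat \<Rightarrow> nat" where
  "num_divisors n = card {m. m dvd n}"

text \<open>In terms of integer arithmetic, the norm of a difference is what one expects.\<close>

lemma sq_norm_vec_diff:
  assumes "n \<ge> 2"
  shows "sq_norm n d (vec_diff n d x y) = (\<Sum>i<d. (x i - y i)\<^sup>2) mod int n"
proof -
  interpret residues "int n" "Zn n"
    using assms by unfold_locales auto
  have neg: "\<ominus>\<^bsub>Zn n\<^esub> b = (- b) mod int n" for b
    by (rule res_neg_eq)
  have minus: "a \<ominus>\<^bsub>Zn n\<^esub> b = (a - b) mod int n" for a b
    by (simp add: a_minus_def neg res_add_eq mod_simps)
  have sq: "a [^]\<^bsub>Zn n\<^esub> (2::nat) = a\<^sup>2 mod int n" if "a \<in> carrier (Zn n)" for a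
    using that assms by (simp add: numeral_2_eq_2 res_mult_eq res_one_eq mod_simps)
  have cl: "(a - b) mod int n \<in> carrier (Zn n)" for a b
    using assms by (simp add: res_carrier_eq)
  have fs: "(\<Oplus>\<^bsub>Zn n\<^esub>i\<in>A. f i mod int n) = (\<Sum>i\<in>A. f i) mod int n"
    if "finite A" for A :: "nat set" and f :: "nat \<Rightarrow> int"
    using that
  proof (induction A rule: finite_induct)
    case empty
    then show ?case by (simp add: res_zero_eq)
  next
    case (insert a A)
    have "(\<lambda>i. f i mod int n) \<in> insert a A \<rightarrow> carrier (Zn n)"
      using assms by (auto simp: res_carrier_eq)
    then show ?case
      using insert by (simp add: finsum_insert Pi_def res_add_eq mod_simps)
  qed
  have "sq_norm n d (vec_diff n d x y) = (\<Oplus>\<^bsub>Zn n\<^esub>i\<in>{..<d}. (x i - y i)\<^sup>2 mod int n)"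
    unfolding sq_norm_def vec_diff_def
  proof (rule finsum_cong')
    show "(\<lambda>i. (x i - y i)\<^sup>2 mod int n) \<in> {..<d} \<rightarrow> carrier (Zn n)"
      using assms by (auto simp: res_carrier_eq)
  qed (use cl in \<open>simp_all add: minus sq power_mod\<close>)
  then show ?thesis by (simp add: fs)
qed

end

theory Submission
  imports Defs "HOL-Analysis.Convex"
begin

text \<open>
  Applying Cauchy--Schwarz to the fibres of the distance maps, it suffices to bound the energy
  \<open>S\<^sub>k\<close>, the number of tuples \<open>(x, x', y\<^sup>1, \<dots>, y\<^sup>k)\<close> in \<open>E\<close> with \<open>x\<close> and \<open>x'\<close> at the same
  distance from every \<open>y\<^sup>j\<close>. For \<open>F \<subseteq> E\<close> let \<open>P\<^sub>y(F)\<close> be the number of pairs in \<open>F\<close> equidistant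
  from \<open>y\<close>. As \<open>P\<^sub>y(F) - |F|\<^sup>2/n\<close> is never negative, its sum over \<open>y \<in> E\<close> is at most its sum over the
  whole space. There the points equidistant from \<open>x\<close> and \<open>x'\<close> form a hyperplane of at most
  \<open>n\<^sup>d\<^sup>-\<^sup>1 gcd(x - x', n)\<close> points, and the pairs with a large gcd are rare; this yields
  \<open>\<Sum>\<^sub>y P\<^sub>y(F) \<le> |E||F|\<^sup>2/n + R|F|\<close> with \<open>R = \<tau>(n) n\<^sup>d (n/\<gamma>(n))\<^sup>d\<^sup>-\<^sup>1\<close>. Splitting \<open>E\<close> into the fibres
  of the first \<open>k\<close> distances gives \<open>S\<^sub>k\<^sub>+\<^sub>1 \<le> (|E|/n) S\<^sub>k + R|E|\<^sup>k\<^sup>+\<^sup>1\<close>, and the hypothesis on \<open>|E|\<close> says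
  precisely that \<open>R n\<^sup>k\<close> is at most a constant multiple of \<open>|E|\<^sup>2\<close>.
\<close>

section \<open>Counting solutions of linear congruences\<close>

lemma card_residue_class:
  fixes m q c :: int
  assumes "q > 0" "q dvd m" "m \<ge> 0"
  shows "card {v \<in> {0..<m}. [v = c] (mod q)} = nat (m div q)"
proof -
  have "{v \<in> {0..<m}. [v = c] (mod q)} = (\<lambda>j. c mod q + q * j) ` {0..<m div q}"
  proof (intro equalityI subsetI)
    fix v assume v: "v \<in> {v \<in> {0..<m}. [v = c] (mod q)}"
    then have "v = c mod q + q * (v div q)"
      by (simp add: cong_def) (metis mod_mult_div_eq)
    moreover have "v div q < m div q"
    proof (rule ccontr)
      assume "\<not> v div q < m div q"
      then have "q * (m div q) \<le> q * (v div q)"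
        using assms by (intro mult_left_mono) auto
      also have "\<dots> \<le> v"
        using assms by (metis add_increasing2 mult_div_mod_eq order_refl pos_mod_sign)
      finally show False
        using v assms by simp
    qed
    moreover have "v div q \<ge> 0"
      using v assms by (simp add: pos_imp_zdiv_nonneg_iff)
    ultimately show "v \<in> (\<lambda>j. c mod q + q * j) ` {0..<m div q}"
      by (metis imageI atLeastLessThan_iff)
  next
    fix v assume "v \<in> (\<lambda>j. c mod q + q * j) ` {0..<m div q}"
    then obtain j where j: "0 \<le> j" "j < m div q" "v = c mod q + q * j"
      by auto
    have "q * (j + 1) \<le> q * (m div q)"
      using j assms by (intro mult_left_mono) auto
    moreover have "c mod q < q"
      using assms by simp
    ultimately have "v < m"
      using j(3) assms(2) unfolding distrib_left by simp
    then show "v \<in> {v \<in> {0..<m}. [v = c] (mod q)}"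
      using j assms by (simp add: cong_def)
  qed
  moreover have "inj_on (\<lambda>j. c mod q + q * j) {0..<m div q}"
    using assms by (auto simp: inj_on_def)
  ultimately show ?thesis
    by (simp add: card_image)
qed

text \<open>With \<open>h = gcd a g\<close>, cancelling \<open>h\<close> leaves a coefficient
  \<open>a div h\<close> that is invertible modulo \<open>q = g div h\<close>, so all solutions
  share one residue class modulo \<open>q\<close>, and that class has \<open>m div q\<close>
  members. Multiplying through by \<open>g\<close> avoids a quotient.\<close>

lemma card_linear_congruence_one_variable:
  fixes a b g m :: int
  assumes "g > 0" "g dvd m" "m \<ge> 0"
  shows "g * int (card {v \<in> {0..<m}. [a * v = b] (mod g)}) \<le> m * gcd a g"
proof (cases "\<exists>v0. [a * v0 = b] (mod g)")
  case False
  then show ?thesis using assms by simp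
next
  case True
  then obtain v0 where v0: "[a * v0 = b] (mod g)" by blast
  define h where "h = gcd a g"
  define q where "q = g div h"
  have "h > 0"
    using assms by (simp add: h_def)
  have hq: "g = h * q" and ha: "h * (a div h) = a"
    by (simp_all add: q_def h_def)
  have "q > 0"
    using assms(1) \<open>h > 0\<close> unfolding hq by (rule zero_less_mult_pos)
  have "q dvd m"
    using assms(2) unfolding hq by (rule dvd_mult_right)
  have "coprime q (a div h)"
    unfolding q_def h_def using assms(1) by (subst coprime_commute, intro div_gcd_coprime) simp
  have "[v = v0] (mod q)" if "[a * v = b] (mod g)" for v
  proof -
    have "g dvd a * v - a * v0"
      using cong_trans[OF that cong_sym[OF v0]] by (simp add: cong_iff_dvd_diff)
    also have "a * v - a * v0 = h * ((a div h) * (v - v0))"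
      by (simp only: ha right_diff_distrib flip: mult.assoc)
    finally have "q dvd (a div h) * (v - v0)"
      using \<open>h > 0\<close> hq by simp
    then show ?thesis
      using \<open>coprime q (a div h)\<close>
      unfolding cong_iff_dvd_diff by (simp only: coprime_dvd_mult_right_iff)
  qed
  then have "card {v \<in> {0..<m}. [a * v = b] (mod g)} \<le> card {v \<in> {0..<m}. [v = v0] (mod q)}"
    by (intro card_mono rev_finite_subset[OF finite_atLeastLessThan_int[of 0 m]]) auto
  also have "\<dots> = nat (m div q)"
    using \<open>q > 0\<close> \<open>q dvd m\<close> assms by (rule_tac card_residue_class)
  finally have "int (card {v \<in> {0..<m}. [a * v = b] (mod g)}) \<le> m div q"
    using \<open>q > 0\<close> assms by (simp add: le_nat_iff pos_imp_zdiv_nonneg_iff)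
  then have "g * int (card {v \<in> {0..<m}. [a * v = b] (mod g)}) \<le> g * (m div q)"
    using assms by (intro mult_left_mono) auto
  also have "\<dots> = m * gcd a g"
    unfolding h_def[symmetric] using \<open>q dvd m\<close> by (simp add: hq mult.assoc)
  finally show ?thesis .
qed

lemma Znd_eq: "Znd n d = {..<d} \<rightarrow>\<^sub>E {0..<int n}"
proof -
  have "carrier (Zn n) = {0..<int n}"
    unfolding residue_ring_def partial_object.select_convs by auto
  then show ?thesis
    by (simp only: Znd_def)
qed

lemma finite_Znd [simp]: "finite (Znd n d)"
  by (simp add: Znd_eq finite_PiE)

lemma card_Znd: "card (Znd n d) = n ^ d"
  by (simp add: Znd_eq card_PiE)

text \<open>Induction on \<open>d\<close>, splitting off the last coordinate \<open>v\<close>. The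
  other coordinates solve a congruence with right-hand side \<open>b - a d * v\<close>, which is why
  \<open>b\<close> is arbitrary. The one-variable bound for \<open>v\<close> turns the gcd
  \<open>g\<close> of \<open>n\<close> and the first \<open>d\<close> coefficients into
  \<open>gcd (a d) g\<close>.\<close>

lemma card_linear_congruence:
  fixes a :: "nat \<Rightarrow> int"
  assumes "n > 0"
  shows "int n * int (card {y \<in> Znd n d. [(\<Sum>i<d. a i * y i) = b] (mod int n)})
    \<le> int n ^ d * Gcd (insert (int n) (a ` {..<d}))"
proof (induction d arbitrary: b)
  case 0
  have "card {y \<in> Znd n 0. [(\<Sum>i<0. a i * y i) = b] (mod int n)} \<le> card (Znd n 0)"
    by (intro card_mono) auto
  then have "int n * int (card {y \<in> Znd n 0. [(\<Sum>i<0. a i * y i) = b] (mod int n)}) \<le> int n * 1"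
    by (intro mult_left_mono) (auto simp: card_Znd)
  then show ?case by simp
next
  case (Suc d)
  define g where "g = Gcd (insert (int n) (a ` {..<d}))"
  have g_dvd: "g dvd int n" "\<And>i. i < d \<Longrightarrow> g dvd a i"
    unfolding g_def by (rule Gcd_dvd; simp)+
  have "g \<noteq> 0"
    using assms g_dvd(1) by auto
  moreover have "g \<ge> 0"
    unfolding g_def by (rule Gcd_int_greater_eq_0)
  ultimately have "g > 0"
    by simp
  let ?T = "{y \<in> Znd n (Suc d). [(\<Sum>i<Suc d. a i * y i) = b] (mod int n)}"
  let ?V = "{v \<in> {0..<int n}. [a d * v = b] (mod g)}"
  let ?U = "\<lambda>v. {y \<in> Znd n d. [(\<Sum>i<d. a i * y i) = b - a d * v] (mod int n)}"
  let ?f = "\<lambda>y. (y d, restrict y {..<d})"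
  have finV: "finite ?V"
    by (rule rev_finite_subset[OF finite_atLeastLessThan_int[of 0 "int n"]]) auto
  have inj: "inj_on ?f ?T"
  proof (rule inj_onI)
    fix x y assume xy: "x \<in> ?T" "y \<in> ?T" "?f x = ?f y"
    show "x = y"
    proof (rule PiE_ext)
      show "x \<in> {..<Suc d} \<rightarrow>\<^sub>E {0..<int n}" "y \<in> {..<Suc d} \<rightarrow>\<^sub>E {0..<int n}"
        using xy by (simp_all add: Znd_eq)
      show "x i = y i" if "i \<in> {..<Suc d}" for i
      proof (cases "i = d")
        case False
        then have "i < d"
          using that by simp
        have "restrict x {..<d} i = restrict y {..<d} i"
          using xy(3) by (simp only: prod.inject)
        then show ?thesis
          using \<open>i < d\<close> by simp
      qed (use xy in simp)
    qed
  qed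
  have sub: "?f ` ?T \<subseteq> Sigma ?V ?U"
  proof
    fix p assume "p \<in> ?f ` ?T"
    then obtain y where y: "y \<in> Znd n (Suc d)" "[(\<Sum>i<Suc d. a i * y i) = b] (mod int n)"
      and p: "p = ?f y"
      by blast
    have "[(\<Sum>i<d. a i * y i) = b - a d * y d] (mod int n)"
      using y(2) by (simp add: cong_iff_dvd_diff algebra_simps)
    moreover have "[a d * y d = b] (mod g)"
    proof -
      have "g dvd (\<Sum>i<d. a i * y i) + a d * y d - b"
        using dvd_trans[OF g_dvd(1)] y(2) by (simp add: cong_iff_dvd_diff)
      moreover have "g dvd (\<Sum>i<d. a i * y i)"
        using g_dvd by (intro dvd_sum) auto
      ultimately have "g dvd (\<Sum>i<d. a i * y i) + a d * y d - b - (\<Sum>i<d. a i * y i)"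
        by (rule dvd_diff)
      then show ?thesis
        by (simp add: cong_iff_dvd_diff)
    qed
    ultimately show "p \<in> Sigma ?V ?U"
      using y(1) p by (auto simp: Znd_eq PiE_iff)
  qed
  have "card ?T = card (?f ` ?T)"
    using inj by (simp add: card_image)
  also have "\<dots> \<le> card (Sigma ?V ?U)"
    by (intro card_mono finite_SigmaI finV sub) simp
  also have "\<dots> = (\<Sum>v\<in>?V. card (?U v))"
    by (intro card_SigmaI finV ballI) simp
  finally have "int n * int (card ?T) \<le> int n * int (\<Sum>v\<in>?V. card (?U v))"
    by (intro mult_left_mono of_nat_mono of_nat_0_le_iff)
  also have "\<dots> = (\<Sum>v\<in>?V. int n * int (card (?U v)))"
    by (simp only: of_nat_sum sum_distrib_left)
  also have "\<dots> \<le> (\<Sum>v\<in>?V. int n ^ d * g)"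
    unfolding g_def by (intro sum_mono Suc.IH)
  also have "\<dots> = int n ^ d * (g * int (card ?V))"
    by simp
  also have "\<dots> \<le> int n ^ d * (int n * gcd (a d) g)"
    using \<open>g > 0\<close> g_dvd(1)
    by (intro mult_left_mono card_linear_congruence_one_variable) auto
  also have "gcd (a d) g = Gcd (insert (int n) (a ` {..<Suc d}))"
    by (simp add: g_def lessThan_Suc gcd.left_commute)
  finally show ?case by (simp add: mult_ac)
qed

section \<open>Equidistant points and sums of gcds\<close>

abbreviation zdist :: "nat \<Rightarrow> nat \<Rightarrow> (nat \<Rightarrow> int) \<Rightarrow> (nat \<Rightarrow> int) \<Rightarrow> int" where
  "zdist n d x y \<equiv> sq_norm n d (vec_diff n d x y)"

text \<open>The squares of the \<open>y i\<close> cancel in the difference of the two norms, so the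
  condition is linear in \<open>y\<close>.\<close>

lemma zdist_eq_iff:
  assumes "n \<ge> 2"
  shows "zdist n d x y = zdist n d x' y \<longleftrightarrow>
    [(\<Sum>i<d. 2 * (x' i - x i) * y i) = (\<Sum>i<d. (x' i)\<^sup>2 - (x i)\<^sup>2)] (mod int n)"
proof -
  have "(\<Sum>i<d. (x i - y i)\<^sup>2) - (\<Sum>i<d. (x' i - y i)\<^sup>2) =
      (\<Sum>i<d. 2 * (x' i - x i) * y i) - (\<Sum>i<d. (x' i)\<^sup>2 - (x i)\<^sup>2)"
    unfolding sum_subtractf[symmetric]
    by (intro sum.cong) (auto simp: power2_eq_square algebra_simps)
  then show ?thesis
    unfolding sq_norm_vec_diff[OF assms] cong_iff_dvd_diff mod_eq_dvd_iff by (simp only:)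
qed

lemma least_prime_divisor_pos: "n \<ge> 2 \<Longrightarrow> least_prime_divisor n > 0"
proof -
  assume "n \<ge> 2"
  then have "\<exists>p. prime p \<and> p dvd n"
    by (intro prime_factor_nat) auto
  then have "prime (least_prime_divisor n)"
    unfolding least_prime_divisor_def by (rule LeastI2_ex) auto
  then show ?thesis by (rule prime_gt_0_nat)
qed

lemma least_prime_divisor_le:
  assumes "m dvd n" "m > 1"
  shows "least_prime_divisor n \<le> m"
proof -
  obtain p where "prime p" "p dvd m"
    using assms prime_factor_nat by (metis less_irrefl)
  then have "least_prime_divisor n \<le> p"
    unfolding least_prime_divisor_def using assms by (intro Least_le) (auto intro: dvd_trans)
  also have "p \<le> m"
    using \<open>p dvd m\<close> assms by (intro dvd_imp_le) auto
  finally show ?thesis .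
qed

lemma card_Znd_congruent:
  assumes "n > 0" "m dvd n"
  shows "card {x' \<in> Znd n d. \<forall>i<d. [x' i = x i] (mod int m)} = (n div m) ^ d"
proof -
  have "{x' \<in> Znd n d. \<forall>i<d. [x' i = x i] (mod int m)}
      = (\<Pi>\<^sub>E i\<in>{..<d}. {v \<in> {0..<int n}. [v = x i] (mod int m)})"
    unfolding Znd_eq PiE_iff set_eq_iff mem_Collect_eq lessThan_iff by blast
  moreover have "card {v \<in> {0..<int n}. [v = x i] (mod int m)} = nat (int n div int m)" for i
    by (rule card_residue_class) (use assms dvd_pos_nat[OF assms] in simp_all)
  moreover have "nat (int n div int m) = n div m"
    by (simp only: nat_int flip: zdiv_int)
  ultimately show ?thesis
    by (simp add: card_PiE)
qed

text \<open>A gcd above 1 is a divisor \<open>m\<close> of \<open>n\<close> modulo which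
  \<open>x'\<close> and \<open>x\<close> agree, so the gcd minus 1 is at most the sum of all such
  \<open>m\<close>. After exchanging sums, \<open>m\<close> contributes
  \<open>m (n/m)^d = n (n/m)^(d-1)\<close>, largest when \<open>m\<close> is smallest. Subtracting 1
  makes the generic \<open>x'\<close>, those with gcd 1, contribute nothing.\<close>

lemma sum_Gcd_le:
  assumes "n \<ge> 3" "odd n" "d \<ge> 1"
  shows "(\<Sum>x'\<in>Znd n d. real_of_int (Gcd (insert (int n) ((\<lambda>i. 2 * (x' i - x i)) ` {..<d}))) - 1)
    \<le> real n * real (num_divisors n) * (real n / real (least_prime_divisor n)) ^ (d - 1)"
proof -
  define G where "G x' = Gcd (insert (int n) ((\<lambda>i. 2 * (x' i - x i)) ` {..<d}))" for x'
  define D where "D = {m. m dvd n \<and> m > 1}"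
  have fin: "finite {m. m dvd n}"
    using assms by (intro finite_divisors_nat) auto
  then have "finite D"
    by (rule rev_finite_subset) (auto simp: D_def)
  have le: "real_of_int (G x') - 1
      \<le> (\<Sum>m\<in>D. real m * of_bool (\<forall>i<d. [x' i = x i] (mod int m)))" for x'
  proof (cases "G x' > 1")
    case False
    then have "real_of_int (G x') - 1 \<le> 0" by simp
    also have "0 \<le> (\<Sum>m\<in>D. real m * of_bool (\<forall>i<d. [x' i = x i] (mod int m)))"
      by (intro sum_nonneg) auto
    finally show ?thesis .
  next
    case True
    define m where "m = nat (G x')"
    have m: "int m = G x'" using True by (simp add: m_def)
    have "int m dvd int n"
      unfolding m G_def by (intro Gcd_dvd) auto
    then have mn: "m dvd n" by simp
    then have "m \<in> D"
      using True m by (auto simp: D_def)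
    \<comment> \<open>Oddness of \<open>n\<close> enters here: it allows the factor 2 in the
      coefficients to be cancelled modulo \<open>m\<close>.\<close>
    have "odd m"
      using mn assms(2) by (meson dvd_trans)
    have "[x' i = x i] (mod int m)" if "i < d" for i
    proof -
      have "int m dvd 2 * (x' i - x i)"
        unfolding m G_def using that by (intro Gcd_dvd) auto
      moreover have "coprime (int m) 2"
        using \<open>odd m\<close> by simp
      ultimately show ?thesis
        unfolding cong_iff_dvd_diff by (simp only: coprime_dvd_mult_right_iff)
    qed
    then have "real_of_int (G x') - 1 \<le> real m * of_bool (\<forall>i<d. [x' i = x i] (mod int m))"
      by (simp flip: m)
    also have "\<dots> \<le> (\<Sum>m\<in>D. real m * of_bool (\<forall>i<d. [x' i = x i] (mod int m)))"
      by (rule member_le_sum[of m D "\<lambda>m. real m * of_bool (\<forall>i<d. [x' i = x i] (mod int m))"])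
        (use \<open>m \<in> D\<close> \<open>finite D\<close> in auto)
    finally show ?thesis .
  qed
  have term_le: "real m * real (card {x' \<in> Znd n d. \<forall>i<d. [x' i = x i] (mod int m)})
      \<le> real n * (real n / real (least_prime_divisor n)) ^ (d - 1)" if "m \<in> D" for m
  proof -
    have m: "m dvd n" "m > 1" using that by (auto simp: D_def)
    \<comment> \<open>Since \<open>d\<close> is positive, one factor \<open>n/m\<close> of the power
      can absorb \<open>m\<close>.\<close>
    obtain e where e: "d = Suc e"
      using assms(3) by (cases d) auto
    have "real m * real (card {x' \<in> Znd n d. \<forall>i<d. [x' i = x i] (mod int m)})
        = real m * (real n / real m) ^ d"
      using assms m by (subst card_Znd_congruent) (auto simp: real_of_nat_div)
    also have "\<dots> = real n * (real n / real m) ^ (d - 1)"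
      using m by (simp add: e)
    also have "\<dots> \<le> real n * (real n / real (least_prime_divisor n)) ^ (d - 1)"
      using assms least_prime_divisor_le[OF m] least_prime_divisor_pos[of n]
      by (intro mult_left_mono power_mono divide_left_mono) auto
    finally show ?thesis .
  qed
  have "(\<Sum>x'\<in>Znd n d. real_of_int (G x') - 1)
      \<le> (\<Sum>x'\<in>Znd n d. \<Sum>m\<in>D. real m * of_bool (\<forall>i<d. [x' i = x i] (mod int m)))"
    by (intro sum_mono le)
  also have "\<dots> = (\<Sum>m\<in>D. real m * real (card {x' \<in> Znd n d. \<forall>i<d. [x' i = x i] (mod int m)}))"
    by (subst sum.swap) (simp add: sum_distrib_left[symmetric] Int_def)
  also have "\<dots> \<le> (\<Sum>m\<in>D. real n * (real n / real (least_prime_divisor n)) ^ (d - 1))"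
    by (intro sum_mono term_le)
  also have "\<dots> = real (card D) * (real n * (real n / real (least_prime_divisor n)) ^ (d - 1))"
    by simp
  also have "\<dots> \<le> real (num_divisors n) * (real n * (real n / real (least_prime_divisor n)) ^ (d - 1))"
    unfolding num_divisors_def using fin
    by (intro mult_right_mono of_nat_mono card_mono) (auto simp: D_def)
  finally show ?thesis
    by (simp add: G_def mult_ac)
qed

section \<open>Collisions of a map and Cauchy-Schwarz\<close>

text \<open>Pairs are ordered and include the diagonal, so the cardinality is exactly the second
  moment of the fibre sizes.\<close>

definition collisions :: "('a \<Rightarrow> 'b) \<Rightarrow> 'a set \<Rightarrow> ('a \<times> 'a) set" where
  "collisions f A = {(x, x'). x \<in> A \<and> x' \<in> A \<and> f x = f x'}"

lemma finite_collisions [simp]: "finite A \<Longrightarrow> finite (collisions f A)"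
  by (rule finite_subset[of _ "A \<times> A"]) (auto simp: collisions_def)

lemma sum_card_fibers: "finite A \<Longrightarrow> (\<Sum>t\<in>h ` A. card {x \<in> A. h x = t}) = card A"
  using sum.image_gen[of A "\<lambda>_. 1::nat" h] by simp

text \<open>A collision of the combined map is a collision of \<open>f\<close> inside one fibre of
  \<open>h\<close>. This lets a further centre be treated fibre by fibre.\<close>

lemma sum_card_collisions_fibers:
  assumes "finite A"
  shows "(\<Sum>t\<in>h ` A. card (collisions f {x \<in> A. h x = t})) = card (collisions (\<lambda>x. (h x, f x)) A)"
proof -
  have "card (collisions (\<lambda>x. (h x, f x)) A) = card (\<Union>t\<in>h ` A. collisions f {x \<in> A. h x = t})"
    by (rule arg_cong[where f = card]) (auto simp: collisions_def)
  also have "\<dots> = (\<Sum>t\<in>h ` A. card (collisions f {x \<in> A. h x = t}))"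
    using assms by (intro card_UN_disjoint ballI impI finite_collisions) (auto simp: collisions_def)
  finally show ?thesis by simp
qed

lemma card_collisions:
  assumes "finite A"
  shows "card (collisions f A) = (\<Sum>t\<in>f ` A. (card {x \<in> A. f x = t})\<^sup>2)"
proof -
  \<comment> \<open>With a constant second map every pair inside a fibre collides, which produces
    the squares.\<close>
  have "collisions (\<lambda>_. ()) {x \<in> A. f x = t} = {x \<in> A. f x = t} \<times> {x \<in> A. f x = t}" for t
    by (auto simp: collisions_def)
  moreover have "collisions (\<lambda>x. (f x, ())) A = collisions f A"
    by (auto simp: collisions_def)
  ultimately show ?thesis
    using sum_card_collisions_fibers[OF assms, of "\<lambda>_. ()" f]
    by (simp add: card_cartesian_product power2_eq_square)
qed

lemma card_squared_le_collisions:
  assumes "finite A"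
  shows "(real (card A))\<^sup>2 \<le> real (card (f ` A)) * real (card (collisions f A))"
proof -
  have "(real (card A))\<^sup>2 = (\<Sum>t\<in>f ` A. real (card {x \<in> A. f x = t}))\<^sup>2"
    by (subst sum_card_fibers[OF assms, of f, symmetric]) simp
  also have "\<dots> \<le> (\<Sum>t\<in>f ` A. (real (card {x \<in> A. f x = t}))\<^sup>2) * real (card (f ` A))"
    by (rule sum_squared_le_sum_of_squares)
  also have "\<dots> = real (card (f ` A)) * real (card (collisions f A))"
    by (simp add: card_collisions[OF assms])
  finally show ?thesis .
qed

section \<open>Collisions of distances to a single centre\<close>

definition err :: "nat \<Rightarrow> nat \<Rightarrow> real" where
  "err n d = real n ^ d * real (num_divisors n) * (real n / real (least_prime_divisor n)) ^ (d - 1)"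

lemma err_nonneg: "err n d \<ge> 0"
  by (simp add: err_def)

text \<open>The mean \<open>|F|^2/n\<close> is subtracted before the centres are extended from
  \<open>E\<close> to the whole space, so the main term keeps the factor \<open>|E|\<close> instead
  of \<open>n^d\<close>. Over the whole space the part 1 of each gcd matches the mean exactly, and
  \<open>sum_Gcd_le\<close> bounds the rest. The error is linear in \<open>|F|\<close>, hence can be
  summed over disjoint fibres.\<close>

lemma sum_collisions_zdist_le:
  assumes "n \<ge> 3" "odd n" "d \<ge> 1" "E \<subseteq> Znd n d" "F \<subseteq> Znd n d"
  shows "(\<Sum>y\<in>E. real (card (collisions (\<lambda>x. zdist n d x y) F)))
    \<le> real (card E) * (real (card F))\<^sup>2 / real n + err n d * real (card F)"
proof -
  let ?Z = "Znd n d"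
  let ?c = "\<lambda>y. real (card (collisions (\<lambda>x. zdist n d x y) F))"
  let ?G = "\<lambda>x x'. real_of_int (Gcd (insert (int n) ((\<lambda>i. 2 * (x' i - x i)) ` {..<d})))"
  have n: "real n > 0" "n \<ge> 2" using assms by auto
  have finF: "finite F"
    using assms(5) by (rule finite_subset) simp
  \<comment> \<open>Distances take at most \<open>n\<close> values, so Cauchy-Schwarz forces at
    least the mean number of collisions for every single centre.\<close>
  have nonneg: "?c y - (real (card F))\<^sup>2 / real n \<ge> 0" for y
  proof -
    have "(\<lambda>x. zdist n d x y) ` F \<subseteq> {0..<int n}"
      using n by (auto simp: sq_norm_vec_diff)
    then have "card ((\<lambda>x. zdist n d x y) ` F) \<le> n"
      by (metis card_atLeastLessThan_int card_mono diff_zero finite_atLeastLessThan_int nat_int)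
    then have "real (card ((\<lambda>x. zdist n d x y) ` F)) * ?c y \<le> real n * ?c y"
      by (intro mult_right_mono) auto
    then have "(real (card F))\<^sup>2 \<le> real n * ?c y"
      using card_squared_le_collisions[OF finF, of "\<lambda>x. zdist n d x y"] by linarith
    then show ?thesis
      using n by (simp add: field_simps)
  qed
  have count: "real (card {y \<in> ?Z. zdist n d x y = zdist n d x' y}) \<le> real n ^ d / real n * ?G x x'"
    for x x'
  proof -
    have "int n * int (card {y \<in> ?Z. zdist n d x y = zdist n d x' y})
      \<le> int n ^ d * Gcd (insert (int n) ((\<lambda>i. 2 * (x' i - x i)) ` {..<d}))"
      unfolding zdist_eq_iff[OF n(2)] using n by (intro card_linear_congruence) auto
    then have "real n * real (card {y \<in> ?Z. zdist n d x y = zdist n d x' y}) \<le> real n ^ d * ?G x x'"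
      by (metis (mono_tags, lifting) of_int_le_iff of_int_mult of_int_of_nat_eq of_int_power)
    then show ?thesis
      using n by (simp add: field_simps)
  qed
  have G: "?G x x' - 1 \<ge> 0" for x x'
  proof -
    have "Gcd (insert (int n) ((\<lambda>i. 2 * (x' i - x i)) ` {..<d})) \<noteq> 0"
      using n by (auto simp: Gcd_0_iff)
    then have "Gcd (insert (int n) ((\<lambda>i. 2 * (x' i - x i)) ` {..<d})) \<ge> 1"
      by (metis Gcd_int_greater_eq_0 order_le_less int_one_le_iff_zero_less)
    then show ?thesis by linarith
  qed
  have "(\<Sum>y\<in>?Z. ?c y)
      = (\<Sum>y\<in>?Z. \<Sum>x\<in>F. \<Sum>x'\<in>F. of_bool (zdist n d x y = zdist n d x' y))"
  proof (rule sum.cong)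
    fix y
    have "collisions (\<lambda>x. zdist n d x y) F
        = (SIGMA x:F. {x' \<in> F. zdist n d x y = zdist n d x' y})"
      by (auto simp: collisions_def)
    then show "?c y = (\<Sum>x\<in>F. \<Sum>x'\<in>F. of_bool (zdist n d x y = zdist n d x' y))"
      using finF by (simp add: Int_def)
  qed simp
  also have "\<dots> = (\<Sum>x\<in>F. \<Sum>y\<in>?Z. \<Sum>x'\<in>F. of_bool (zdist n d x y = zdist n d x' y))"
    by (rule sum.swap)
  also have "\<dots> = (\<Sum>x\<in>F. \<Sum>x'\<in>F. \<Sum>y\<in>?Z. of_bool (zdist n d x y = zdist n d x' y))"
    by (intro sum.cong refl sum.swap)
  also have "\<dots> = (\<Sum>x\<in>F. \<Sum>x'\<in>F. real (card {y \<in> ?Z. zdist n d x y = zdist n d x' y}))"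
    by (simp add: Int_def)
  also have "\<dots> \<le> (\<Sum>x\<in>F. \<Sum>x'\<in>F. real n ^ d / real n * ?G x x')"
    by (intro sum_mono count)
  also have "\<dots> = real n ^ d / real n * (\<Sum>x\<in>F. \<Sum>x'\<in>F. ?G x x')"
    by (simp add: sum_distrib_left)
  finally have upper: "(\<Sum>y\<in>?Z. ?c y) \<le> real n ^ d / real n * (\<Sum>x\<in>F. \<Sum>x'\<in>F. ?G x x')" .
  have "(\<Sum>x'\<in>F. ?G x x' - 1)
      \<le> real n * real (num_divisors n) * (real n / real (least_prime_divisor n)) ^ (d - 1)" for x
  proof -
    \<comment> \<open>Every gcd is at least 1, so enlarging \<open>F\<close> to the whole space only
      adds nonnegative terms.\<close>
    have "(\<Sum>x'\<in>F. ?G x x' - 1) \<le> (\<Sum>x'\<in>?Z. ?G x x' - 1)"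
      using assms G by (intro sum_mono2) auto
    then show ?thesis
      using sum_Gcd_le[OF assms(1-3), of x] by linarith
  qed
  then have "(\<Sum>x\<in>F. \<Sum>x'\<in>F. ?G x x' - 1)
      \<le> (\<Sum>x\<in>F. real n * real (num_divisors n) * (real n / real (least_prime_divisor n)) ^ (d - 1))"
    by (intro sum_mono)
  then have Gsum: "(\<Sum>x\<in>F. \<Sum>x'\<in>F. ?G x x') - (real (card F))\<^sup>2 \<le> real (card F) *
      (real n * real (num_divisors n) * (real n / real (least_prime_divisor n)) ^ (d - 1))"
    by (simp add: sum_subtractf power2_eq_square)
  have "(\<Sum>y\<in>E. ?c y) - real (card E) * (real (card F))\<^sup>2 / real n
      = (\<Sum>y\<in>E. ?c y - (real (card F))\<^sup>2 / real n)"
    by (simp add: sum_subtractf)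
  also have "\<dots> \<le> (\<Sum>y\<in>?Z. ?c y - (real (card F))\<^sup>2 / real n)"
    using assms nonneg by (intro sum_mono2) auto
  also have "\<dots> = (\<Sum>y\<in>?Z. ?c y) - real n ^ d / real n * (real (card F))\<^sup>2"
    by (simp add: sum_subtractf card_Znd)
  also have "\<dots> \<le> real n ^ d / real n * ((\<Sum>x\<in>F. \<Sum>x'\<in>F. ?G x x') - (real (card F))\<^sup>2)"
    using upper by (simp only: right_diff_distrib)
  also have "\<dots> \<le> real n ^ d / real n * (real (card F) *
      (real n * real (num_divisors n) * (real n / real (least_prime_divisor n)) ^ (d - 1)))"
    by (intro mult_left_mono Gsum) auto
  also have "\<dots> = err n d * real (card F)"
    using n by (simp add: err_def field_simps)
  finally show ?thesis by simp
qed

section \<open>The energy of \<open>k\<close>-stars\<close>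

definition star_map ::
    "nat \<Rightarrow> nat \<Rightarrow> nat \<Rightarrow> (nat \<Rightarrow> nat \<Rightarrow> int) \<Rightarrow> (nat \<Rightarrow> int) \<Rightarrow> (nat \<Rightarrow> int)" where
  "star_map n d k y x = (\<lambda>j\<in>{..<k}. zdist n d x (y j))"

definition star_energy :: "nat \<Rightarrow> nat \<Rightarrow> nat \<Rightarrow> (nat \<Rightarrow> int) set \<Rightarrow> real" where
  "star_energy n d k E = (\<Sum>y\<in>{..<k} \<rightarrow>\<^sub>E E. real (card (collisions (star_map n d k y) E)))"

lemma star_map_eq_iff:
  "star_map n d k y x = star_map n d k y x' \<longleftrightarrow> (\<forall>j<k. zdist n d x (y j) = zdist n d x' (y j))"
  by (auto simp: star_map_def restrict_def fun_eq_iff)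

lemma collisions_star_map_Suc:
  "collisions (star_map n d (Suc k) (y(k := v))) E
    = collisions (\<lambda>x. (star_map n d k y x, zdist n d x v)) E"
  by (auto simp: collisions_def star_map_eq_iff less_Suc_eq)

text \<open>The first \<open>k\<close> centres are fixed and the new centre \<open>v\<close> is
  averaged over \<open>E\<close>. The one-centre bound applies to each fibre of the first
  \<open>k\<close> distances; the squared fibre sizes add up to the old collision count and the
  sizes to \<open>|E|\<close>.\<close>

lemma star_energy_Suc:
  assumes "n \<ge> 3" "odd n" "d \<ge> 1" "E \<subseteq> Znd n d"
  shows "star_energy n d (Suc k) E
    \<le> real (card E) / real n * star_energy n d k E + err n d * real (card E) ^ Suc k"
proof -
  let ?P = "{..<k} \<rightarrow>\<^sub>E E"
  have finE: "finite E"
    using assms(4) by (rule finite_subset) simp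
  have step: "(\<Sum>v\<in>E. real (card (collisions (\<lambda>x. (star_map n d k y x, zdist n d x v)) E)))
      \<le> real (card E) / real n * real (card (collisions (star_map n d k y) E))
        + err n d * real (card E)" for y
  proof -
    let ?h = "star_map n d k y"
    let ?F = "\<lambda>t. {x \<in> E. ?h x = t}"
    have "(\<Sum>v\<in>E. real (card (collisions (\<lambda>x. (?h x, zdist n d x v)) E)))
        = (\<Sum>v\<in>E. \<Sum>t\<in>?h ` E. real (card (collisions (\<lambda>x. zdist n d x v) (?F t))))"
      by (simp flip: sum_card_collisions_fibers[OF finE])
    also have "\<dots> = (\<Sum>t\<in>?h ` E. \<Sum>v\<in>E. real (card (collisions (\<lambda>x. zdist n d x v) (?F t))))"
      by (rule sum.swap)
    also have "\<dots> \<le> (\<Sum>t\<in>?h ` E. real (card E) * (real (card (?F t)))\<^sup>2 / real n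
        + err n d * real (card (?F t)))"
      using assms by (intro sum_mono sum_collisions_zdist_le) auto
    also have "\<dots> = real (card E) / real n * real (\<Sum>t\<in>?h ` E. (card (?F t))\<^sup>2)
        + err n d * real (\<Sum>t\<in>?h ` E. card (?F t))"
      by (simp add: sum.distrib sum_distrib_left)
    also have "\<dots> = real (card E) / real n * real (card (collisions ?h E)) + err n d * real (card E)"
      by (simp only: sum_card_fibers[OF finE] card_collisions[OF finE])
    finally show ?thesis .
  qed
  \<comment> \<open>A tuple of \<open>Suc k\<close> centres is a tuple of \<open>k\<close> centres
    updated at index \<open>k\<close>.\<close>
  have "star_energy n d (Suc k) E
      = (\<Sum>(v, y)\<in>E \<times> ?P. real (card (collisions (star_map n d (Suc k) (y(k := v))) E)))"
    unfolding star_energy_def lessThan_Suc PiE_insert_eq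
    by (subst sum.reindex) (auto intro!: inj_combinator sum.cong)
  also have "\<dots> = (\<Sum>v\<in>E. \<Sum>y\<in>?P. real (card (collisions (\<lambda>x. (star_map n d k y x, zdist n d x v)) E)))"
    by (simp add: sum.cartesian_product collisions_star_map_Suc)
  also have "\<dots> = (\<Sum>y\<in>?P. \<Sum>v\<in>E. real (card (collisions (\<lambda>x. (star_map n d k y x, zdist n d x v)) E)))"
    by (rule sum.swap)
  also have "\<dots> \<le> (\<Sum>y\<in>?P. real (card E) / real n * real (card (collisions (star_map n d k y) E))
      + err n d * real (card E))"
    by (intro sum_mono step)
  also have "\<dots> = real (card E) / real n * star_energy n d k E + err n d * real (card E) ^ Suc k"
    by (simp add: star_energy_def sum.distrib sum_distrib_left card_PiE)
  finally show ?thesis .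
qed

lemma star_energy_le:
  assumes "n \<ge> 3" "odd n" "d \<ge> 1" "E \<subseteq> Znd n d"
  shows "star_energy n d k E
    \<le> real (card E) ^ (k + 2) / real n ^ k + real k * err n d * real (card E) ^ k"
proof (induction k)
  case 0
  \<comment> \<open>With no centres the map is constant, so all \<open>|E|^2\<close> pairs
    collide.\<close>
  have "star_map n d 0 y = (\<lambda>_. \<lambda>_. undefined)" for y
    by (auto simp: star_map_def fun_eq_iff)
  then have "collisions (star_map n d 0 y) E = E \<times> E" for y
    by (auto simp: collisions_def)
  then show ?case
    by (simp add: star_energy_def card_cartesian_product power2_eq_square)
next
  case (Suc k)
  have "real n \<ge> 1" using assms by simp
  have "star_energy n d (Suc k) E
      \<le> real (card E) / real n * star_energy n d k E + err n d * real (card E) ^ Suc k"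
    using assms by (rule star_energy_Suc)
  also have "\<dots> \<le> real (card E) / real n *
      (real (card E) ^ (k + 2) / real n ^ k + real k * err n d * real (card E) ^ k)
      + err n d * real (card E) ^ Suc k"
    using Suc.IH by (intro add_right_mono mult_left_mono) auto
  also have "\<dots> = real (card E) ^ (Suc k + 2) / real n ^ Suc k
      + (real k * err n d * real (card E) ^ Suc k) / real n + err n d * real (card E) ^ Suc k"
    by (simp add: algebra_simps)
  \<comment> \<open>The old error even gains a factor \<open>1/n\<close>. Dropping it costs only the
    constant \<open>k\<close> in the total error.\<close>
  also have "\<dots> \<le> real (card E) ^ (Suc k + 2) / real n ^ Suc k
      + real k * err n d * real (card E) ^ Suc k + err n d * real (card E) ^ Suc k"
  proof -
    have "real k * err n d * real (card E) ^ Suc k / real n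
        \<le> real k * err n d * real (card E) ^ Suc k / 1"
      using \<open>real n \<ge> 1\<close> err_nonneg[of n d] by (intro divide_left_mono) auto
    then show ?thesis by simp
  qed
  also have "\<dots> = real (card E) ^ (Suc k + 2) / real n ^ Suc k
      + real (Suc k) * err n d * real (card E) ^ Suc k"
    by (simp add: algebra_simps)
  finally show ?case .
qed

text \<open>Cauchy-Schwarz is used twice: on the fibres of the star map for each tuple
  \<open>y\<close>, then on the sum over all \<open>|E|^k\<close> tuples. The square roots prepare
  the second use.\<close>

lemma sum_star_set_ge:
  assumes "finite E"
  shows "real (card E) ^ (2 * k + 2)
    \<le> (\<Sum>y\<in>{..<k} \<rightarrow>\<^sub>E E. real (card (star_set n d k y E))) * star_energy n d k E"
proof -
  let ?P = "{..<k} \<rightarrow>\<^sub>E E"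
  let ?a = "\<lambda>y. real (card (star_set n d k y E))"
  let ?c = "\<lambda>y. real (card (collisions (star_map n d k y) E))"
  have "real (card E) \<le> sqrt (?a y) * sqrt (?c y)" for y
  proof -
    have "star_set n d k y E = star_map n d k y ` E"
      by (simp add: star_set_def star_map_def)
    then have "(real (card E))\<^sup>2 \<le> ?a y * ?c y"
      using card_squared_le_collisions[OF assms, of "star_map n d k y"] by simp
    then show ?thesis
      by (simp add: real_le_rsqrt flip: real_sqrt_mult)
  qed
  then have "(\<Sum>y\<in>?P. real (card E)) \<le> (\<Sum>y\<in>?P. sqrt (?a y) * sqrt (?c y))"
    by (intro sum_mono)
  then have "real (card E) ^ k * real (card E) \<le> (\<Sum>y\<in>?P. sqrt (?a y) * sqrt (?c y))"
    by (simp add: card_PiE)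
  then have "(real (card E) ^ k * real (card E))\<^sup>2 \<le> (\<Sum>y\<in>?P. sqrt (?a y) * sqrt (?c y))\<^sup>2"
    by (intro power_mono) auto
  also have "\<dots> \<le> (\<Sum>y\<in>?P. (sqrt (?a y))\<^sup>2) * (\<Sum>y\<in>?P. (sqrt (?c y))\<^sup>2)"
    by (rule Cauchy_Schwarz_ineq_sum)
  also have "\<dots> = (\<Sum>y\<in>?P. ?a y) * star_energy n d k E"
    by (simp add: star_energy_def)
  also have "(real (card E) ^ k * real (card E))\<^sup>2 = real (card E) ^ (2 * k + 2)"
    by (simp add: power_mult_distrib power_even_eq flip: power2_eq_square)
  finally show ?thesis .
qed

section \<open>The size hypothesis and the conclusion\<close>

lemma threshold_squared:
  assumes "n \<ge> 2" "d \<ge> 1"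
  shows "(sqrt (real (num_divisors n)) * real n powr (real d + (real k - 1) / 2)
      / real (least_prime_divisor n) powr ((real d - 1) / 2))\<^sup>2 = err n d * real n ^ k"
proof -
  have n: "real n > 0" using assms by simp
  have g: "real (least_prime_divisor n) > 0"
    using least_prime_divisor_pos[OF assms(1)] by simp
  have "(real n powr (real d + (real k - 1) / 2))\<^sup>2 = real n powr (2 * (real d + (real k - 1) / 2))"
    using n by (simp add: powr_power mult.commute)
  \<comment> \<open>The exponent \<open>2d + k - 1\<close> is split so that \<open>n^(d-1)\<close>
    can pair with the power of the least prime divisor in \<open>err\<close>.\<close>
  also have "2 * (real d + (real k - 1) / 2) = real (d + (d - 1) + k)"
    using assms by (simp add: of_nat_diff)
  also have "real n powr \<dots> = real n ^ d * real n ^ (d - 1) * real n ^ k"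
    using n by (subst powr_realpow) (auto simp: power_add)
  finally have 1: "(real n powr (real d + (real k - 1) / 2))\<^sup>2 = real n ^ d * real n ^ (d - 1) * real n ^ k" .
  have "(real (least_prime_divisor n) powr ((real d - 1) / 2))\<^sup>2
      = real (least_prime_divisor n) powr (real (d - 1))"
    using g assms by (simp add: powr_power of_nat_diff diff_divide_distrib)
  also have "\<dots> = real (least_prime_divisor n) ^ (d - 1)"
    using g by (subst powr_realpow) auto
  finally have 2: "(real (least_prime_divisor n) powr ((real d - 1) / 2))\<^sup>2
      = real (least_prime_divisor n) ^ (d - 1)" .
  show ?thesis
    unfolding power_divide power_mult_distrib 1 2
    by (simp add: err_def power_divide)
qed

theorem theorem4p1:
  fixes d k :: nat
  assumes "d \<ge> 1" and "k \<ge> 1"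
  shows "\<exists>C>0. \<exists>c>0. \<forall>n::nat. \<forall>E. n \<ge> 3 \<longrightarrow> odd n \<longrightarrow> E \<subseteq> Znd n d \<longrightarrow>
    real (card E) \<ge> C * (sqrt (real (num_divisors n)) * real n powr (real d + (real k - 1) / 2)
                        / real (least_prime_divisor n) powr ((real d - 1) / 2)) \<longrightarrow>
    1 / real (card E) ^ k * (\<Sum>y \<in> {..<k} \<rightarrow>\<^sub>E E. real (card (star_set n d k y E)))
      \<ge> c * real n ^ k"
proof -
  \<comment> \<open>The constants are \<open>C = 1\<close> and \<open>c = 1/(k+1)\<close>: in the
    energy the main term counts once, and under the hypothesis each of the \<open>k\<close> error
    terms is at most as large.\<close>
  have main: "1 / real (card E) ^ k * (\<Sum>y \<in> {..<k} \<rightarrow>\<^sub>E E. real (card (star_set n d k y E)))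
      \<ge> 1 / (real k + 1) * real n ^ k"
    if n: "n \<ge> 3" "odd n" and E: "E \<subseteq> Znd n d"
      and large: "real (card E) \<ge> sqrt (real (num_divisors n)) * real n powr (real d + (real k - 1) / 2)
        / real (least_prime_divisor n) powr ((real d - 1) / 2)" (is "_ \<ge> ?Y")
    for n :: nat and E
  proof -
    let ?S = "\<Sum>y \<in> {..<k} \<rightarrow>\<^sub>E E. real (card (star_set n d k y E))"
    let ?e = "real (card E)"
    have finE: "finite E"
      using E by (rule finite_subset) simp
    have npos: "real n > 0" using n by simp
    have "finite {m. m dvd n}"
      using n by (intro finite_divisors_nat) auto
    then have "num_divisors n > 0"
      unfolding num_divisors_def by (subst card_gt_0_iff) auto
    \<comment> \<open>A positive threshold makes \<open>E\<close> nonempty, so powers of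
      \<open>|E|\<close> can be cancelled below.\<close>
    then have "?Y > 0"
      using npos least_prime_divisor_pos[of n] n by simp
    then have epos: "?e > 0"
      using large by linarith
    have "?Y\<^sup>2 \<le> ?e\<^sup>2"
      using large \<open>?Y > 0\<close> by (intro power_mono) auto
    then have err: "err n d \<le> ?e\<^sup>2 / real n ^ k"
      using threshold_squared[of n d k] assms n npos by (simp add: field_simps)
    have "star_energy n d k E \<le> ?e ^ (k + 2) / real n ^ k + real k * err n d * ?e ^ k"
      using n assms E by (intro star_energy_le) auto
    also have "\<dots> \<le> ?e ^ (k + 2) / real n ^ k + real k * (?e\<^sup>2 / real n ^ k) * ?e ^ k"
      using err by (intro add_left_mono mult_right_mono mult_left_mono) auto
    also have "\<dots> = (real k + 1) * ?e ^ (k + 2) / real n ^ k"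
      by (simp add: power_add power2_eq_square add_divide_distrib distrib_right distrib_left mult_ac)
    finally have energy: "star_energy n d k E \<le> (real k + 1) * ?e ^ (k + 2) / real n ^ k" .
    have "?e ^ (2 * k + 2) \<le> ?S * star_energy n d k E"
      by (rule sum_star_set_ge[OF finE])
    also have "\<dots> \<le> ?S * ((real k + 1) * ?e ^ (k + 2) / real n ^ k)"
      by (intro mult_left_mono energy sum_nonneg) auto
    finally have "?e ^ (k + 2) * (real n ^ k * ?e ^ k) \<le> ?e ^ (k + 2) * (?S * (real k + 1))"
      using npos by (simp add: field_simps mult_2_right flip: power_add)
    then have "real n ^ k * ?e ^ k \<le> ?S * (real k + 1)"
      using epos by (simp add: mult_le_cancel_left_pos)
    then show ?thesis
      using epos by (simp add: field_simps)
  qed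
  show ?thesis
    by (rule exI[of _ 1], intro conjI, simp, rule exI[of _ "1 / (real k + 1)"])
      (use main in auto)
qed

end
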